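(* Let $N$ be a finitely generated group which surjects to the finite group $F$. Then for every automorphism $\alpha$ of $N$, with $G=N\rtimes_\alpha\mathbb{Z}$, there are infinitely many $n\ge 1$ such that the cyclic cover $G_n$ of $G$ surjects to $F$.
   Context: For a group $N$ and $\alpha\in\mathrm{Aut}(N)$, the group $G=N\rtimes_\alpha\mathbb{Z}$ is generated by $N$ and an element $t$ generating $\mathbb{Z}$, with $txt^{-1}=\alpha(x)$ for all $x\in N$. For $n\ge 1$, the cyclic cover $G_n$ of $G$ is the index $n$ subgroup $\langle N,t^n\rangle$ (equivalently, the kernel of the map $G\to C_n$ to the cyclic group of order $n$ given by the exponent sum of $t$ modulo $n$). A group surjects to $F$ if there is a surjective homomorphism from it onto $F$. *)

theory Defs
  imports "HOL-Algebra.Bij" "HOL-Algebra.Generated_Groups"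
begin

definition finitely_generated_group :: "('a, 'm) monoid_scheme \<Rightarrow> bool" where
  "finitely_generated_group G \<longleftrightarrow>
     group G \<and> (\<exists>S. finite S \<and> S \<subseteq> carrier G \<and> generate G S = carrier G)"

definition surjects_to :: "('a, 'm) monoid_scheme \<Rightarrow> ('b, 'k) monoid_scheme \<Rightarrow> bool" where
  "surjects_to G F \<longleftrightarrow> epi G F \<noteq> {}"

(* The pair (x, i) stands for x t^i, so that (x t^i) (y t^j) = x \<alpha>^i(y) t^(i+j).
   The power \<alpha>^i is taken in the automorphism group, hence makes sense for negative i. *)
definition semidirect_int :: "('a, 'm) monoid_scheme \<Rightarrow> ('a \<Rightarrow> 'a) \<Rightarrow> ('a \<times> int) monoid" where
  "semidirect_int N \<alpha> =
     \<lparr>carrier = carrier N \<times> UNIV,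
      mult = \<lambda>(x, i) (y, j). (x \<otimes>\<^bsub>N\<^esub> (\<alpha> [^]\<^bsub>AutoGroup N\<^esub> i) y, i + j),
      one = (\<one>\<^bsub>N\<^esub>, 0)\<rparr>"

definition sd_base :: "('a, 'm) monoid_scheme \<Rightarrow> ('a \<times> int) set" where
  "sd_base N = (\<lambda>x. (x, 0)) ` carrier N"

definition sd_t :: "('a, 'm) monoid_scheme \<Rightarrow> 'a \<times> int" where
  "sd_t N = (\<one>\<^bsub>N\<^esub>, 1)"

definition cyclic_cover ::
    "('a, 'm) monoid_scheme \<Rightarrow> ('a \<Rightarrow> 'a) \<Rightarrow> nat \<Rightarrow> ('a \<times> int) monoid" where
  "cyclic_cover N \<alpha> n =
     subgroup_generated (semidirect_int N \<alpha>)
       (insert (sd_t N [^]\<^bsub>semidirect_int N \<alpha>\<^esub> n) (sd_base N))"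

context
  fixes N :: "('a, 'm) monoid_scheme" (structure) and \<alpha> :: "'a \<Rightarrow> 'a"
  assumes N: "group N" and \<alpha>: "\<alpha> \<in> auto N"
begin

interpretation N: group N by (rule N)
interpretation A: group "AutoGroup N" by (rule N.AutoGroup)

lemma carrier_AutoGroup: "carrier (AutoGroup N) = auto N"
  by (simp add: AutoGroup_def)

lemma AutoGroup_int_pow_in_auto: "\<alpha> [^]\<^bsub>AutoGroup N\<^esub> (i::int) \<in> auto N"
  using A.int_pow_closed \<alpha> carrier_AutoGroup by blast

lemma AutoGroup_int_pow_closed:
  "x \<in> carrier N \<Longrightarrow> (\<alpha> [^]\<^bsub>AutoGroup N\<^esub> (i::int)) x \<in> carrier N"
  using AutoGroup_int_pow_in_auto[of i] by (auto simp: auto_def hom_def)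

lemma AutoGroup_int_pow_mult:
  "\<lbrakk>x \<in> carrier N; y \<in> carrier N\<rbrakk> \<Longrightarrow>
   (\<alpha> [^]\<^bsub>AutoGroup N\<^esub> (i::int)) (x \<otimes> y) =
   (\<alpha> [^]\<^bsub>AutoGroup N\<^esub> i) x \<otimes> (\<alpha> [^]\<^bsub>AutoGroup N\<^esub> i) y"
  using AutoGroup_int_pow_in_auto[of i] by (auto simp: auto_def hom_def)

lemma AutoGroup_int_pow_add:
  assumes "x \<in> carrier N"
  shows "(\<alpha> [^]\<^bsub>AutoGroup N\<^esub> (i + j :: int)) x =
         (\<alpha> [^]\<^bsub>AutoGroup N\<^esub> i) ((\<alpha> [^]\<^bsub>AutoGroup N\<^esub> j) x)"
proof -
  have "\<alpha> [^]\<^bsub>AutoGroup N\<^esub> (i + j) =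
        \<alpha> [^]\<^bsub>AutoGroup N\<^esub> i \<otimes>\<^bsub>AutoGroup N\<^esub> \<alpha> [^]\<^bsub>AutoGroup N\<^esub> j"
    using \<alpha> carrier_AutoGroup by (simp add: A.int_pow_mult)
  also have "\<dots> = compose (carrier N) (\<alpha> [^]\<^bsub>AutoGroup N\<^esub> i) (\<alpha> [^]\<^bsub>AutoGroup N\<^esub> j)"
    using AutoGroup_int_pow_in_auto[of i] AutoGroup_int_pow_in_auto[of j]
    by (simp add: AutoGroup_def BijGroup_def auto_def)
  finally show ?thesis using assms by (simp add: compose_def)
qed

lemma AutoGroup_int_pow_zero: "x \<in> carrier N \<Longrightarrow> (\<alpha> [^]\<^bsub>AutoGroup N\<^esub> (0::int)) x = x"
  by (simp add: AutoGroup_def BijGroup_def)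

lemma group_semidirect_int: "group (semidirect_int N \<alpha>)"
proof (rule groupI)
  fix g assume "g \<in> carrier (semidirect_int N \<alpha>)"
  then obtain x i where g: "g = (x, i)" "x \<in> carrier N"
    by (auto simp: semidirect_int_def)
  have "((\<alpha> [^]\<^bsub>AutoGroup N\<^esub> (- i)) (inv x), - i) \<otimes>\<^bsub>semidirect_int N \<alpha>\<^esub> g
        = \<one>\<^bsub>semidirect_int N \<alpha>\<^esub>"
    using g AutoGroup_int_pow_mult[of "inv x" x "- i"]
      AutoGroup_int_pow_mult[of \<one> \<one> "- i"] AutoGroup_int_pow_closed[of \<one> "- i"]
    by (simp add: semidirect_int_def N.l_cancel_one)
  moreover have "((\<alpha> [^]\<^bsub>AutoGroup N\<^esub> (- i)) (inv x), - i) \<in> carrier (semidirect_int N \<alpha>)"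
    using g by (simp add: semidirect_int_def AutoGroup_int_pow_closed)
  ultimately show "\<exists>h\<in>carrier (semidirect_int N \<alpha>). h \<otimes>\<^bsub>semidirect_int N \<alpha>\<^esub> g
        = \<one>\<^bsub>semidirect_int N \<alpha>\<^esub>"
    by blast
next
  fix g h k
  assume "g \<in> carrier (semidirect_int N \<alpha>)" "h \<in> carrier (semidirect_int N \<alpha>)"
    "k \<in> carrier (semidirect_int N \<alpha>)"
  then obtain x i y j z l where g: "g = (x, i)" "h = (y, j)" "k = (z, l)"
      "x \<in> carrier N" "y \<in> carrier N" "z \<in> carrier N"
    by (auto simp: semidirect_int_def)
  then show "g \<otimes>\<^bsub>semidirect_int N \<alpha>\<^esub> h \<otimes>\<^bsub>semidirect_int N \<alpha>\<^esub> k
      = g \<otimes>\<^bsub>semidirect_int N \<alpha>\<^esub> (h \<otimes>\<^bsub>semidirect_int N \<alpha>\<^esub> k)"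
    by (simp add: semidirect_int_def AutoGroup_int_pow_closed AutoGroup_int_pow_mult
        AutoGroup_int_pow_add[of z i j] N.m_assoc)
next
  fix g h
  assume "g \<in> carrier (semidirect_int N \<alpha>)" "h \<in> carrier (semidirect_int N \<alpha>)"
  then show "g \<otimes>\<^bsub>semidirect_int N \<alpha>\<^esub> h \<in> carrier (semidirect_int N \<alpha>)"
    by (auto simp: semidirect_int_def AutoGroup_int_pow_closed)
next
  show "\<one>\<^bsub>semidirect_int N \<alpha>\<^esub> \<in> carrier (semidirect_int N \<alpha>)"
    by (simp add: semidirect_int_def)
next
  fix g
  assume "g \<in> carrier (semidirect_int N \<alpha>)"
  then show "\<one>\<^bsub>semidirect_int N \<alpha>\<^esub> \<otimes>\<^bsub>semidirect_int N \<alpha>\<^esub> g = g"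
    by (auto simp: semidirect_int_def AutoGroup_int_pow_zero simp del: int_pow_0)
qed

lemma semidirect_int_conjugation:
  assumes "x \<in> carrier N"
  shows "sd_t N \<otimes>\<^bsub>semidirect_int N \<alpha>\<^esub> (x, 0) \<otimes>\<^bsub>semidirect_int N \<alpha>\<^esub>
         inv\<^bsub>semidirect_int N \<alpha>\<^esub> (sd_t N) = (\<alpha> x, 0)"
proof -
  interpret G: group "semidirect_int N \<alpha>" by (rule group_semidirect_int)
  have p1: "\<alpha> [^]\<^bsub>AutoGroup N\<^esub> (1::int) = \<alpha>"
    using \<alpha> carrier_AutoGroup by (simp add: A.int_pow_1)
  have c: "\<alpha> x \<in> carrier N" "\<alpha> \<one> \<in> carrier N"
    using \<alpha> assms by (auto simp: auto_def hom_def)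
  have "sd_t N \<otimes>\<^bsub>semidirect_int N \<alpha>\<^esub> (x, 0) = (\<alpha> x, 0) \<otimes>\<^bsub>semidirect_int N \<alpha>\<^esub> sd_t N"
    using c by (simp add: semidirect_int_def sd_t_def p1 AutoGroup_int_pow_zero del: int_pow_0)
  moreover have "sd_t N \<in> carrier (semidirect_int N \<alpha>)" "(\<alpha> x, 0) \<in> carrier (semidirect_int N \<alpha>)"
      "(x, 0) \<in> carrier (semidirect_int N \<alpha>)"
    using c assms by (auto simp: semidirect_int_def sd_t_def)
  ultimately show ?thesis by (simp add: G.m_assoc)
qed

lemma sd_t_int_pow: "sd_t N [^]\<^bsub>semidirect_int N \<alpha>\<^esub> (i::int) = (\<one>, i)"
proof -
  interpret G: group "semidirect_int N \<alpha>" by (rule group_semidirect_int)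
  have one: "(\<alpha> [^]\<^bsub>AutoGroup N\<^esub> (j::int)) \<one> = \<one>" for j
    using AutoGroup_int_pow_mult[of \<one> \<one> j] AutoGroup_int_pow_closed[of \<one> j] N.l_cancel_one
    by simp
  have nat: "sd_t N [^]\<^bsub>semidirect_int N \<alpha>\<^esub> (k::nat) = (\<one>, int k)" for k
  proof (induction k)
    case 0
    then show ?case by (simp add: semidirect_int_def)
  next
    case (Suc k)
    have "(\<one>, int k) \<otimes>\<^bsub>semidirect_int N \<alpha>\<^esub> sd_t N = (\<one>, int (Suc k))"
      using one[of "int k"] by (simp add: semidirect_int_def sd_t_def)
    with Suc show ?case by simp
  qed
  have t: "sd_t N \<in> carrier (semidirect_int N \<alpha>)" by (simp add: semidirect_int_def sd_t_def)
  show ?thesis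
  proof (cases i rule: int_cases2)
    case (nonneg k)
    then show ?thesis using nat[of k] by (simp only: int_pow_int)
  next
    case (nonpos k)
    have "(\<one>, - int k) \<otimes>\<^bsub>semidirect_int N \<alpha>\<^esub> (\<one>, int k) = \<one>\<^bsub>semidirect_int N \<alpha>\<^esub>"
      by (simp add: semidirect_int_def one)
    then have "inv\<^bsub>semidirect_int N \<alpha>\<^esub> (\<one>, int k) = (\<one>, - int k)"
      by (rule G.inv_equality) (simp_all add: semidirect_int_def)
    with nonpos t nat[of k] show ?thesis by (simp only: G.int_pow_neg_int)
  qed
qed

lemma carrier_cyclic_cover:
  "carrier (cyclic_cover N \<alpha> n) = carrier N \<times> {i. int n dvd i}"
proof -
  let ?G = "semidirect_int N \<alpha>"
  let ?S = "insert (sd_t N [^]\<^bsub>?G\<^esub> n) (sd_base N)"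
  let ?H = "carrier N \<times> {i. int n dvd i}"
  interpret G: group ?G by (rule group_semidirect_int)
  have tn: "sd_t N [^]\<^bsub>?G\<^esub> n = (\<one>, int n)"
    using sd_t_int_pow[of "int n"] by (simp add: int_pow_int)
  have S: "?S \<subseteq> carrier ?G"
    unfolding tn by (auto simp: sd_base_def semidirect_int_def)
  have invH: "inv\<^bsub>?G\<^esub> (x, i) = ((\<alpha> [^]\<^bsub>AutoGroup N\<^esub> (- i)) (inv x), - i)"
    if "x \<in> carrier N" for x i
  proof (rule G.inv_equality)
    show "((\<alpha> [^]\<^bsub>AutoGroup N\<^esub> (- i)) (inv x), - i) \<otimes>\<^bsub>?G\<^esub> (x, i) = \<one>\<^bsub>?G\<^esub>"
      using that AutoGroup_int_pow_mult[of "inv x" x "- i"]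
        AutoGroup_int_pow_mult[of \<one> \<one> "- i"] AutoGroup_int_pow_closed[of \<one> "- i"]
      by (simp add: semidirect_int_def N.l_cancel_one)
  qed (use that in \<open>simp_all add: semidirect_int_def AutoGroup_int_pow_closed\<close>)
  have "subgroup ?H ?G"
  proof (rule G.subgroupI)
    fix a assume "a \<in> ?H"
    then show "inv\<^bsub>?G\<^esub> a \<in> ?H"
      by (auto simp: invH intro!: AutoGroup_int_pow_closed)
  next
    show "?H \<noteq> {}" using N.one_closed by auto
  qed (auto simp: semidirect_int_def intro!: AutoGroup_int_pow_closed)
  moreover have "?S \<subseteq> ?H"
    unfolding tn by (auto simp: sd_base_def)
  ultimately have "generate ?G ?S \<subseteq> ?H"
    using G.generate_subgroup_incl by blast
  moreover have "?H \<subseteq> generate ?G ?S"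
  proof
    fix a assume "a \<in> ?H"
    then obtain x k where a: "a = (x, int n * k)" "x \<in> carrier N" by (auto simp: dvd_def)
    have sub: "subgroup (generate ?G ?S) ?G" by (rule G.generate_is_subgroup[OF S])
    have "(sd_t N [^]\<^bsub>?G\<^esub> n) [^]\<^bsub>?G\<^esub> k \<in> generate ?G ?S"
      by (rule G.subgroup_int_pow_closed[OF sub]) (simp add: generate.incl)
    moreover have "(sd_t N [^]\<^bsub>?G\<^esub> n) [^]\<^bsub>?G\<^esub> k = (\<one>, int n * k)"
      using sd_t_int_pow[of "int n * k"] G.int_pow_pow[of "sd_t N" "int n" k]
      by (simp add: int_pow_int semidirect_int_def sd_t_def)
    moreover have "(x, 0) \<in> generate ?G ?S"
      using a by (auto simp: sd_base_def intro: generate.incl)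
    ultimately have "(x, 0) \<otimes>\<^bsub>?G\<^esub> (\<one>, int n * k) \<in> generate ?G ?S"
      using generate.eng by metis
    then show "a \<in> generate ?G ?S"
      using a by (simp add: semidirect_int_def AutoGroup_int_pow_zero del: int_pow_0)
  qed
  ultimately have "generate ?G ?S = ?H" by (rule equalityI)
  moreover have "carrier ?G \<inter> ?S = ?S" using S by blast
  ultimately show ?thesis
    by (simp only: cyclic_cover_def carrier_subgroup_generated)
qed

end

end

theory Submission
  imports Defs
begin

text \<open>
  The powers of \<^term>\<open>\<alpha>\<close> act by precomposition on the homomorphisms \<open>N \<rightarrow> F\<close>, of which there are
  only finitely many because they are determined by their values on a finite generating set.
  Hence an epimorphism \<open>f\<close> satisfies \<open>f \<circ> \<alpha>\<^sup>d = f\<close> for some \<open>d \<ge> 1\<close>. For every multiple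
  \<open>n\<close> of \<open>d\<close>, the map \<open>x t\<^sup>i \<mapsto> f x\<close> is then a homomorphism on \<open>G\<^sub>n\<close>.
\<close>

lemma hom_eq_on_generate:
  assumes N: "group N" and F: "group F" and g: "g \<in> hom N F" and h: "h \<in> hom N F"
    and S: "S \<subseteq> carrier N" and eq: "\<And>s. s \<in> S \<Longrightarrow> g s = h s"
    and x: "x \<in> generate N S"
  shows "g x = h x"
proof -
  interpret N: group N by (rule N)
  interpret g: group_hom N F g using N F g by (simp add: group_hom_def group_hom_axioms_def)
  interpret h: group_hom N F h using N F h by (simp add: group_hom_def group_hom_axioms_def)
  show ?thesis
    using x
  proof (induction rule: generate.induct)
    case (inv s)
    then show ?case using S eq by (metis g.hom_inv h.hom_inv subsetD)
  next
    case (eng a b)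
    then show ?case using N.generate_in_carrier[OF S] by simp
  qed (simp_all add: eq)
qed

lemma hom_comp_AutoGroup_int_pow:
  assumes "group N" "\<alpha> \<in> auto N" "f \<in> hom N F"
  shows "(\<lambda>x. f ((\<alpha> [^]\<^bsub>AutoGroup N\<^esub> (i::int)) x)) \<in> hom N F"
  using assms by (auto simp: hom_def Pi_iff AutoGroup_int_pow_closed AutoGroup_int_pow_mult)

text \<open>Pigeonhole yields exponents \<open>i < j\<close> for which precomposing \<open>f\<close>
  with \<alpha>^i and with \<alpha>^j gives the same map. As \<alpha> is invertible, \<alpha>^i
  cancels, leaving \<open>d = j - i\<close>.\<close>

lemma hom_fixed_by_AutoGroup_pow:
  assumes fg: "finitely_generated_group N" and F: "group F" "finite (carrier F)"
    and f: "f \<in> hom N F" and \<alpha>: "\<alpha> \<in> auto N"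
  obtains d :: nat where "d \<ge> 1"
    "\<And>x. x \<in> carrier N \<Longrightarrow> f ((\<alpha> [^]\<^bsub>AutoGroup N\<^esub> int d) x) = f x"
proof -
  obtain S where N: "group N" and S: "finite S" "S \<subseteq> carrier N" "generate N S = carrier N"
    using fg by (auto simp: finitely_generated_group_def)
  define p where "p i x = (\<alpha> [^]\<^bsub>AutoGroup N\<^esub> (i::int)) x" for i x
  have p: "p i x \<in> carrier N" "p (i + j) x = p i (p j x)" "p 0 x = x" if "x \<in> carrier N" for i j x
    unfolding p_def using that N \<alpha>
    by (simp_all add: AutoGroup_int_pow_closed AutoGroup_int_pow_add AutoGroup_int_pow_zero
        del: int_pow_0)
  \<comment> \<open>Restricting to \<open>S\<close> places every \<open>r k\<close> in the
    extensional function space from \<open>S\<close> to \<open>carrier F\<close>, which is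
    finite.\<close>
  define r where "r k = restrict (\<lambda>x. f (p (int k) x)) S" for k
  have "range r \<subseteq> (\<Pi>\<^sub>E x\<in>S. carrier F)"
    unfolding r_def by (intro image_subsetI restrict_PiE_iff[THEN iffD2] ballI hom_in_carrier[OF f] p)
      (use S(2) in blast)
  then have "finite (range r)"
    using S(1) F(2) by (meson finite_PiE finite_subset)
  then have "\<not> inj r" using finite_imageD by blast
  then obtain i j where ij: "i < j" "r i = r j"
    by (metis injI linorder_neqE_nat)
  \<comment> \<open>Both sides are homomorphisms in \<open>x\<close>, so their agreement on the
    generators \<open>S\<close> spreads to all of \<open>N\<close>.\<close>
  have eq: "f (p (int i) x) = f (p (int j) x)" if "x \<in> carrier N" for x
  proof (rule hom_eq_on_generate[where g = "\<lambda>x. f (p (int i) x)", OF N F(1) _ _ S(2)])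
    show "(\<lambda>x. f (p (int i) x)) \<in> hom N F" "(\<lambda>x. f (p (int j) x)) \<in> hom N F"
      unfolding p_def by (intro hom_comp_AutoGroup_int_pow N \<alpha> f)+
    show "f (p (int i) s) = f (p (int j) s)" if "s \<in> S" for s
      using fun_cong[OF ij(2), of s] that by (simp add: r_def)
    show "x \<in> generate N S" using that S(3) by simp
  qed
  show thesis
  proof (rule that)
    show "j - i \<ge> 1" using ij(1) by simp
    fix x assume x: "x \<in> carrier N"
    \<comment> \<open>The cancellation: \<open>eq\<close> is applied at the point
      \<open>p (- int i) x\<close>.\<close>
    have "f (p (int (j - i)) x) = f (p (int j) (p (- int i) x))"
      using x ij(1) p(2)[of x "int j" "- int i"] by (simp add: of_nat_diff)
    also have "\<dots> = f (p (int i) (p (- int i) x))" using eq p(1) x by simp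
    also have "\<dots> = f x" using p(2)[of x "int i" "- int i"] p(3) x by simp
    finally show "f ((\<alpha> [^]\<^bsub>AutoGroup N\<^esub> int (j - i)) x) = f x" by (simp add: p_def)
  qed
qed

text \<open>Since \<open>fixed\<close> holds at every point, in particular at \<alpha>^j(x), raising
  any exponent \<open>j\<close> by \<open>d\<close> leaves the value of \<open>f\<close> unchanged.
  Negative multiples are included because the cover also contains negative powers of t.\<close>

lemma hom_fixed_by_AutoGroup_int_pow_mult:
  assumes N: "group N" and \<alpha>: "\<alpha> \<in> auto N"
    and fixed: "\<And>x. x \<in> carrier N \<Longrightarrow> f ((\<alpha> [^]\<^bsub>AutoGroup N\<^esub> (d::int)) x) = f x"
    and dvd: "d dvd i" and x: "x \<in> carrier N"
  shows "f ((\<alpha> [^]\<^bsub>AutoGroup N\<^esub> i) x) = f x"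
proof -
  have step: "f ((\<alpha> [^]\<^bsub>AutoGroup N\<^esub> (d + j)) x) = f ((\<alpha> [^]\<^bsub>AutoGroup N\<^esub> j) x)" for j
    using N \<alpha> x fixed by (simp add: AutoGroup_int_pow_add AutoGroup_int_pow_closed)
  \<comment> \<open>Induction in both directions from 0; the downward case reads \<open>step\<close>
    backwards, from \<open>d * k\<close> to \<open>d * (k - 1)\<close>.\<close>
  have "f ((\<alpha> [^]\<^bsub>AutoGroup N\<^esub> (d * k)) x) = f x" for k
  proof (induction k rule: int_induct[where k = 0])
    case base
    show ?case using AutoGroup_int_pow_zero[OF N \<alpha> x] by simp
  next
    case (step1 k)
    then show ?case using step[of "d * k"] by (simp add: algebra_simps)
  next
    case (step2 k)
    then show ?case using step[of "d * (k - 1)"] by (simp add: algebra_simps)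
  qed
  with dvd show ?thesis by (auto simp: dvd_def)
qed

text \<open>The product of \<open>(x, i)\<close> and \<open>(y, j)\<close> has first component x
  \<alpha>^i(y). In the cover \<open>n\<close> divides \<open>i\<close>, so \<open>f\<close> does
  not see the twist \<alpha>^i, and forgetting the exponent becomes multiplicative.\<close>

lemma surjects_to_cyclic_cover:
  assumes N: "group N" and \<alpha>: "\<alpha> \<in> auto N" and f: "f \<in> epi N F"
    and fixed: "\<And>x. x \<in> carrier N \<Longrightarrow> f ((\<alpha> [^]\<^bsub>AutoGroup N\<^esub> int n) x) = f x"
  shows "surjects_to (cyclic_cover N \<alpha> n) F"
proof -
  have hom: "f \<in> hom N F" and surj: "f ` carrier N = carrier F"
    using f by (auto simp: epi_def)
  note carrier = carrier_cyclic_cover[OF N \<alpha>, of n]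
  have "(\<lambda>(x, i). f x) \<in> hom (cyclic_cover N \<alpha> n) F"
  proof (rule homI)
    fix a assume "a \<in> carrier (cyclic_cover N \<alpha> n)"
    then show "(case a of (x, i) \<Rightarrow> f x) \<in> carrier F"
      using hom unfolding carrier by (auto simp: hom_def)
  next
    fix a b assume "a \<in> carrier (cyclic_cover N \<alpha> n)" "b \<in> carrier (cyclic_cover N \<alpha> n)"
    then obtain x i y j where ab: "a = (x, i)" "b = (y, j)" "x \<in> carrier N" "y \<in> carrier N"
        and i: "int n dvd i"
      unfolding carrier by auto
    then show "(case a \<otimes>\<^bsub>cyclic_cover N \<alpha> n\<^esub> b of (x, i) \<Rightarrow> f x) =
        (case a of (x, i) \<Rightarrow> f x) \<otimes>\<^bsub>F\<^esub> (case b of (x, i) \<Rightarrow> f x)"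
      using hom hom_fixed_by_AutoGroup_int_pow_mult[of N \<alpha> f "int n" i y, OF N \<alpha> fixed i]
      by (simp add: cyclic_cover_def semidirect_int_def hom_mult[OF hom]
          AutoGroup_int_pow_closed[OF N \<alpha>])
  qed
  \<comment> \<open>The elements \<open>(x, 0)\<close> lie in the cover and already attain every
    value of \<open>f\<close>.\<close>
  moreover have "(\<lambda>(x, i). f x) ` carrier (cyclic_cover N \<alpha> n) = carrier F"
    unfolding carrier surj[symmetric] by force
  ultimately show ?thesis by (auto simp: surjects_to_def epi_def)
qed

theorem corollary4p2:
  fixes N :: "('a, 'm) monoid_scheme" and F :: "('b, 'k) monoid_scheme"
  assumes "finitely_generated_group N"
    and "group F" and "finite (carrier F)"
    and "surjects_to N F"
  shows "\<forall>\<alpha>\<in>auto N. infinite {n::nat. n \<ge> 1 \<and> surjects_to (cyclic_cover N \<alpha> n) F}"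
proof
  fix \<alpha> assume \<alpha>: "\<alpha> \<in> auto N"
  have N: "group N" using assms(1) by (simp add: finitely_generated_group_def)
  obtain f where f: "f \<in> epi N F" using assms(4) by (auto simp: surjects_to_def)
  then have "f \<in> hom N F" by (simp add: epi_def)
  then obtain d :: nat where d: "d \<ge> 1"
      and fixed: "\<And>x. x \<in> carrier N \<Longrightarrow> f ((\<alpha> [^]\<^bsub>AutoGroup N\<^esub> int d) x) = f x"
    using hom_fixed_by_AutoGroup_pow[OF assms(1-3) _ \<alpha>] by blast
  have "surjects_to (cyclic_cover N \<alpha> (d * k)) F" for k
    by (rule surjects_to_cyclic_cover[OF N \<alpha> f], rule hom_fixed_by_AutoGroup_int_pow_mult[OF N \<alpha>])
      (use fixed in auto)
  \<comment> \<open>\<open>Suc k\<close> avoids the multiple 0, which is not an admissible index;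
    \<open>d \<ge> 1\<close> makes the listed multiples positive and pairwise distinct.\<close>
  then have "range (\<lambda>k. d * Suc k) \<subseteq> {n. n \<ge> 1 \<and> surjects_to (cyclic_cover N \<alpha> n) F}"
    using d by (auto simp del: mult_Suc_right)
  moreover have "infinite (range (\<lambda>k. d * Suc k))"
    using d by (intro notI) (auto dest!: finite_imageD simp: inj_on_def)
  ultimately show "infinite {n. n \<ge> 1 \<and> surjects_to (cyclic_cover N \<alpha> n) F}"
    by (rule infinite_super)
qed

end
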